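(* Let $N\ge 3$, $1\le r\le N$, and let $R$ be a set consisting of $r$ rim vertices of the wheel graph $W_{N+1}$ with central vertex $c$. Let $d_1,\ldots,d_r$ be the cyclic intervals of $R$. Then the number of rooted spanning forests of $W_{N+1}$ with root set $\{c\}\cup R$ is $$\mathcal F_{W_{N+1}}(\{c\}\cup R)=\prod_{i=1}^{r}F_{2d_i}.$$
   Context: The wheel graph $W_{N+1}$ ($N\ge3$) has vertex set $\{c,v_1,\ldots,v_N\}$ and edges $\{v_i,v_{i+1}\}$ (indices modulo $N$) and $\{c,v_i\}$ for $1\le i\le N$; $c$ is the central vertex and the $v_i$ are the rim vertices. For a set $R=\{v_{a_1},\ldots,v_{a_r}\}$ of rim vertices with $1\le a_1<\cdots<a_r\le N$, the cyclic intervals are $d_i=a_{i+1}-a_i$ for $1\le i\le r-1$ and $d_r=a_1+N-a_r$. For a finite connected graph $G$ and $\varnothing\ne S\subseteq V(G)$, a rooted spanning forest of $G$ with root set $S$ is a spanning forest (an acyclic subgraph containing all vertices of $G$) in which each connected component contains exactly one vertex of $S$; $\mathcal F_G(S)$ denotes the number of such forests. Fibonacci numbers: $F_0=0$, $F_1=1$, $F_{n+2}=F_{n+1}+F_n$. *)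

theory Defs
  imports "HOL-Number_Theory.Fib"
begin

section \<open>Finite simple graphs\<close>

record 'a ugraph =
  verts :: "'a set"
  edges :: "'a set set"

definition simple_graph :: "'a ugraph \<Rightarrow> bool" where
  "simple_graph G \<longleftrightarrow> finite (verts G) \<and> (\<forall>e\<in>edges G. e \<subseteq> verts G \<and> card e = 2)"

definition subgraph :: "'a ugraph \<Rightarrow> 'a ugraph \<Rightarrow> bool" where
  "subgraph H G \<longleftrightarrow> simple_graph H \<and> verts H \<subseteq> verts G \<and> edges H \<subseteq> edges G"

text \<open>Walks and cycles are given by their vertex lists; a one-element list is a trivial walk.\<close>

definition walk :: "'a ugraph \<Rightarrow> 'a list \<Rightarrow> bool" where
  "walk G p \<longleftrightarrow> p \<noteq> [] \<and> set p \<subseteq> verts G \<and>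
     (\<forall>i. Suc i < length p \<longrightarrow> {p ! i, p ! Suc i} \<in> edges G)"

definition cycle :: "'a ugraph \<Rightarrow> 'a list \<Rightarrow> bool" where
  "cycle G p \<longleftrightarrow> walk G p \<and> distinct p \<and> 3 \<le> length p \<and> {last p, hd p} \<in> edges G"

definition joined :: "'a ugraph \<Rightarrow> 'a \<Rightarrow> 'a \<Rightarrow> bool" where
  "joined G u v \<longleftrightarrow> (\<exists>p. walk G p \<and> hd p = u \<and> last p = v)"

definition connected_graph :: "'a ugraph \<Rightarrow> bool" where
  "connected_graph G \<longleftrightarrow> verts G \<noteq> {} \<and> (\<forall>u\<in>verts G. \<forall>v\<in>verts G. joined G u v)"

definition acyclic_graph :: "'a ugraph \<Rightarrow> bool" where
  "acyclic_graph G \<longleftrightarrow> \<not> (\<exists>p. cycle G p)"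

text \<open>Connected components, represented by their vertex sets.\<close>

definition graph_components :: "'a ugraph \<Rightarrow> 'a set set" where
  "graph_components G = (\<lambda>u. {v. joined G u v}) ` verts G"


section \<open>Rooted spanning forests\<close>

definition spanning_forest :: "'a ugraph \<Rightarrow> 'a ugraph \<Rightarrow> bool" where
  "spanning_forest G H \<longleftrightarrow> subgraph H G \<and> verts H = verts G \<and> acyclic_graph H"

definition rooted_spanning_forest :: "'a ugraph \<Rightarrow> 'a set \<Rightarrow> 'a ugraph \<Rightarrow> bool" where
  "rooted_spanning_forest G S H \<longleftrightarrow>
     spanning_forest G H \<and> (\<forall>C\<in>graph_components H. \<exists>!s. s \<in> C \<and> s \<in> S)"

text \<open>Only meant for finite connected \<open>G\<close> and nonempty \<open>S \<subseteq> verts G\<close>.\<close>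

definition num_rooted_forests :: "'a ugraph \<Rightarrow> 'a set \<Rightarrow> nat" where
  "num_rooted_forests G S = card {H. rooted_spanning_forest G S H}"


section \<open>The wheel graph\<close>

datatype wheel_vertex = Center | Rim nat

text \<open>The rim indices are \<open>1, \<dots>, N\<close>; the cyclic successor of \<open>i\<close> in this range is
  \<open>i mod N + 1\<close>. The graph called \<open>wheel N\<close> has \<open>N + 1\<close> vertices.\<close>

definition rim :: "nat \<Rightarrow> wheel_vertex set" where
  "rim N = Rim ` {1..N}"

definition wheel :: "nat \<Rightarrow> wheel_vertex ugraph" where
  "wheel N = \<lparr> verts = insert Center (rim N),
     edges = {{Rim i, Rim (i mod N + 1)} | i. i \<in> {1..N}} \<union> {{Center, Rim i} | i. i \<in> {1..N}} \<rparr>"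

text \<open>For \<open>R = {Rim a\<^sub>1, \<dots>, Rim a\<^sub>r}\<close> with \<open>a\<^sub>1 < \<dots> < a\<^sub>r\<close>, \<open>rim_index R i\<close> is \<open>a\<^sub>i\<close>
  for \<open>1 \<le> i \<le> r\<close>.\<close>

definition rim_index :: "wheel_vertex set \<Rightarrow> nat \<Rightarrow> nat" where
  "rim_index R i = sorted_list_of_set {j. Rim j \<in> R} ! (i - 1)"

definition cyclic_interval :: "nat \<Rightarrow> wheel_vertex set \<Rightarrow> nat \<Rightarrow> nat" where
  "cyclic_interval N R i =
     (if i < card R then rim_index R (i + 1) - rim_index R i
      else rim_index R 1 + N - rim_index R (card R))"


section \<open>Sanity checks\<close>

lemma simple_graph_wheel:
  assumes "N \<ge> 3"
  shows "simple_graph (wheel N)"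
proof -
  have "i mod N + 1 \<in> {1..N} \<and> i mod N + 1 \<noteq> i" if "i \<in> {1..N}" for i
    using that assms by (cases "i = N") (auto simp: Suc_le_eq)
  then show ?thesis
    by (fastforce simp: simple_graph_def wheel_def rim_def card_2_iff)
qed

lemma connected_graph_wheel: "connected_graph (wheel N)"
proof -
  have edge: "{Center, Rim i} \<in> edges (wheel N)" "{Rim i, Center} \<in> edges (wheel N)"
    if "i \<in> {1..N}" for i
    using that by (auto simp: wheel_def insert_commute)
  have "\<exists>p. walk (wheel N) p \<and> hd p = u \<and> last p = v"
    if u: "u \<in> verts (wheel N)" and v: "v \<in> verts (wheel N)" for u v
  proof -
    have V: "verts (wheel N) = insert Center (rim N)" by (simp add: wheel_def)
    consider "u = Center" "v = Center" | "u = Center" "v \<in> rim N" | "u \<in> rim N" "v = Center"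
      | "u \<in> rim N" "v \<in> rim N"
      using u v V by auto
    then show ?thesis
    proof cases
      case 1
      then show ?thesis by (intro exI[of _ "[Center]"]) (simp add: walk_def V)
    next
      case 2
      then show ?thesis using edge
        by (intro exI[of _ "[Center, v]"]) (auto simp: walk_def V rim_def)
    next
      case 3
      then show ?thesis using edge
        by (intro exI[of _ "[u, Center]"]) (auto simp: walk_def V rim_def)
    next
      case 4
      then show ?thesis using edge
        by (intro exI[of _ "[u, Center, v]"]) (auto simp: walk_def V rim_def less_Suc_eq nth_Cons')
    qed
  qed
  then show ?thesis
    by (auto simp: connected_graph_def joined_def wheel_def)
qed

lemma rim_index:
  assumes "R \<subseteq> rim N"
  shows "strict_mono_on {1..card R} (rim_index R)"
    and "R = (\<lambda>i. Rim (rim_index R i)) ` {1..card R}"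
proof -
  let ?A = "{j. Rim j \<in> R}"
  have R: "R = Rim ` ?A" using assms by (auto simp: rim_def)
  have "finite R" using assms by (rule finite_subset) (simp add: rim_def)
  then have fin: "finite ?A"
    by (metis R finite_imageD inj_onI wheel_vertex.inject)
  have len: "card ?A = card R"
    by (metis R card_image inj_onI wheel_vertex.inject)
  show "strict_mono_on {1..card R} (rim_index R)"
  proof (rule strict_mono_onI)
    fix i j assume "i \<in> {1..card R}" "j \<in> {1..card R}" "i < j"
    then show "rim_index R i < rim_index R j"
      unfolding rim_index_def
      by (intro sorted_wrt_nth_less[OF strict_sorted_list_of_set]) (auto simp: len)
  qed
  have "?A = rim_index R ` {1..card R}"
  proof -
    have "?A = (\<lambda>k. sorted_list_of_set ?A ! k) ` {0..<card R}"
      using nth_image[of "length (sorted_list_of_set ?A)" "sorted_list_of_set ?A"] fin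
      by (simp add: len lessThan_atLeast0)
    also have "\<dots> = rim_index R ` Suc ` {0..<card R}"
      by (simp add: rim_index_def image_image del: image_Suc_atLeastLessThan)
    also have "Suc ` {0..<card R} = {1..card R}"
      by (simp add: image_Suc_atLeastLessThan atLeastLessThanSuc_atLeastAtMost)
    finally show ?thesis .
  qed
  then show "R = (\<lambda>i. Rim (rim_index R i)) ` {1..card R}"
    by (metis R image_image)
qed

end

theory Submission
  imports Defs "HOL-Number_Theory.Cong" "HOL-Library.FuncSet"
begin

text \<open>A rooted spanning forest with root set \<open>S\<close> is the same as a choice of a parent for every vertex
  outside \<open>S\<close> such that following parents always leads to \<open>S\<close>. In the wheel, a rim vertex that is not
  a root chooses its predecessor, its successor or the center, and since there is a root on the rim,
  the only obstruction is a pair of consecutive vertices choosing each other. Cutting the rim at a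
  root turns the choices into words in which ``successor'' is never followed by ``predecessor''.
  As words are extended past nonroots, their number satisfies \<open>W\<^sub>n\<^sub>+\<^sub>1 = 3 W\<^sub>n - W\<^sub>n\<^sub>-\<^sub>1\<close>, which is the
  recursion of \<open>F\<^sub>2\<^sub>n\<close>, and every root restarts it.\<close>

section \<open>Walks and adjacency\<close>

definition adj :: "'a ugraph \<Rightarrow> ('a \<times> 'a) set" where
  "adj G = {(u, v). {u, v} \<in> edges G}"

lemma adj_iff [simp]: "(u, v) \<in> adj G \<longleftrightarrow> {u, v} \<in> edges G"
  by (simp add: adj_def)

lemma sym_adj: "sym (adj G)"
  by (auto simp: sym_def insert_commute)

lemma adj_rtrancl_sym: "(u, v) \<in> (adj G)\<^sup>* \<Longrightarrow> (v, u) \<in> (adj G)\<^sup>*"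
  using sym_adj sym_rtrancl symD by metis

lemma walk_Cons:
  "walk G (x # p) \<longleftrightarrow> x \<in> verts G \<and> (p = [] \<or> {x, hd p} \<in> edges G \<and> walk G p)"
  by (cases p) (auto simp: walk_def nth_Cons' less_Suc_eq_0_disj)

lemma walk_append: "walk G (p @ q) \<Longrightarrow> q \<noteq> [] \<Longrightarrow> walk G q"
  by (induction p) (auto simp: walk_Cons)

lemma walk_imp_rtrancl: "walk G p \<Longrightarrow> (hd p, last p) \<in> (adj G)\<^sup>*"
proof (induction p)
  case Nil
  then show ?case by (simp add: walk_def)
next
  case (Cons x p)
  then show ?case
    by (cases "p = []") (auto simp: walk_Cons intro: converse_rtrancl_into_rtrancl)
qed

text \<open>A new first vertex is either put in front of the walk or, if the walk already visits it,
  the part before that visit is cut off. Distinctness matters because such walks will be closed up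
  to cycles.\<close>

lemma rtrancl_imp_distinct_walk:
  assumes "simple_graph G" "(u, v) \<in> (adj G)\<^sup>*" "v \<in> verts G"
  shows "\<exists>p. walk G p \<and> distinct p \<and> hd p = u \<and> last p = v"
  using assms(2)
proof (induction rule: converse_rtrancl_induct)
  case base
  then show ?case
    using assms(3) by (intro exI[of _ "[v]"]) (simp add: walk_Cons)
next
  case (step u y)
  then obtain p where p: "walk G p" "distinct p" "hd p = y" "last p = v" by blast
  show ?case
  proof (cases "u \<in> set p")
    case True
    then obtain ys zs where "p = ys @ u # zs" by (meson split_list)
    then show ?thesis
      using p by (intro exI[of _ "u # zs"]) (auto dest: walk_append)
  next
    case False
    have "u \<in> verts G"
      using step(1) assms(1) by (auto simp: simple_graph_def)
    moreover have "p \<noteq> []" using p(1) by (simp add: walk_def)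
    ultimately show ?thesis
      using False p step(1) by (intro exI[of _ "u # p"]) (auto simp: walk_Cons)
  qed
qed

text \<open>The closure relates even a non-vertex to itself, hence the conjunct
  \<open>v \<in> verts G\<close>.\<close>

lemma joined_iff_rtrancl:
  assumes "simple_graph G"
  shows "joined G u v \<longleftrightarrow> v \<in> verts G \<and> (u, v) \<in> (adj G)\<^sup>*"
proof
  assume "joined G u v"
  then obtain p where p: "walk G p" "hd p = u" "last p = v" by (auto simp: joined_def)
  then have "v \<in> verts G" by (auto simp: walk_def)
  then show "v \<in> verts G \<and> (u, v) \<in> (adj G)\<^sup>*" using p walk_imp_rtrancl by blast
next
  assume "v \<in> verts G \<and> (u, v) \<in> (adj G)\<^sup>*"
  then show "joined G u v"
    using rtrancl_imp_distinct_walk[OF assms] unfolding joined_def by blast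
qed

lemma cycle_edge:
  assumes "cycle G p" "i < length p"
  shows "{p ! i, p ! (Suc i mod length p)} \<in> edges G"
proof (cases "Suc i < length p")
  case True
  then show ?thesis using assms by (simp add: cycle_def walk_def)
next
  case False
  then have "Suc i = length p" using assms by simp
  moreover from this have "p \<noteq> []" "i = length p - 1" by auto
  ultimately show ?thesis using assms by (simp add: cycle_def last_conv_nth hd_conv_nth)
qed

text \<open>The two neighbours are the cyclic successor and predecessor of \<open>v\<close> on the
  cycle; length at least 3 keeps them apart.\<close>

lemma cycle_two_neighbours:
  assumes "cycle G p" "v \<in> set p"
  obtains x y where "x \<in> set p" "y \<in> set p" "x \<noteq> y" "{v, x} \<in> edges G" "{v, y} \<in> edges G"
proof -
  let ?n = "length p"
  have n: "?n \<ge> 3" and dist: "distinct p" using assms(1) by (auto simp: cycle_def)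
  obtain i where i: "i < ?n" "v = p ! i" using assms(2) by (metis in_set_conv_nth)
  define k where "k = (if i = 0 then ?n - 1 else i - 1)"
  have k: "k < ?n" "Suc k mod ?n = i" using i n by (auto simp: k_def)
  have ne: "Suc i mod ?n \<noteq> k"
    using i n by (cases "Suc i = ?n") (auto simp: k_def)
  have lt: "Suc i mod ?n < ?n" using n by (intro mod_less_divisor) linarith
  show thesis
  proof (rule that)
    show "p ! (Suc i mod ?n) \<in> set p" "p ! k \<in> set p" using k lt by auto
    show "p ! (Suc i mod ?n) \<noteq> p ! k" using ne k lt dist by (simp add: nth_eq_iff_index_eq)
    show "{v, p ! (Suc i mod ?n)} \<in> edges G" using cycle_edge[OF assms(1) i(1)] i(2) by simp
    show "{v, p ! k} \<in> edges G"
      using cycle_edge[OF assms(1) k(1)] i(2) k(2) by (simp add: insert_commute)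
  qed
qed


section \<open>Rooted forests as parent maps\<close>

text \<open>The strictly decreasing rank \<open>d\<close> expresses that following parents must end
  in \<open>S\<close>. Extensional functions are used so that a map is determined by its values on
  the nonroots, as counting requires.\<close>

definition parent_maps :: "'a ugraph \<Rightarrow> 'a set \<Rightarrow> ('a \<Rightarrow> 'a) set" where
  "parent_maps G S = {f \<in> (verts G - S) \<rightarrow>\<^sub>E verts G.
     (\<forall>v\<in>verts G - S. {v, f v} \<in> edges G) \<and>
     (\<exists>d :: 'a \<Rightarrow> nat. \<forall>v\<in>verts G - S. d (f v) < d v)}"

definition parent_graph :: "'a ugraph \<Rightarrow> 'a set \<Rightarrow> ('a \<Rightarrow> 'a) \<Rightarrow> 'a ugraph" where
  "parent_graph G S f = \<lparr>verts = verts G, edges = (\<lambda>v. {v, f v}) ` (verts G - S)\<rparr>"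

lemma verts_parent_graph [simp]: "verts (parent_graph G S f) = verts G"
  by (simp add: parent_graph_def)

lemma edge_parent_graph:
  "{x, y} \<in> edges (parent_graph G S f) \<longleftrightarrow>
     x \<in> verts G - S \<and> y = f x \<or> y \<in> verts G - S \<and> x = f y"
  by (auto simp: parent_graph_def doubleton_eq_iff)

section \<open>From parent maps to rooted forests\<close>

lemma subgraph_parent_graph:
  assumes "simple_graph G" "f \<in> parent_maps G S"
  shows "subgraph (parent_graph G S f) G"
  using assms by (auto simp: subgraph_def simple_graph_def parent_maps_def parent_graph_def)

text \<open>At a vertex of maximal rank on a cycle, no cycle neighbour can be a child, since
  children have larger rank. So both neighbours are its parent, but they are distinct.\<close>

lemma acyclic_parent_graph:
  assumes "f \<in> parent_maps G S"
  shows "acyclic_graph (parent_graph G S f)"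
  unfolding acyclic_graph_def
proof
  assume "\<exists>p. cycle (parent_graph G S f) p"
  then obtain p where p: "cycle (parent_graph G S f) p" by blast
  obtain d :: "'a \<Rightarrow> nat" where d: "\<And>v. v \<in> verts G - S \<Longrightarrow> d (f v) < d v"
    using assms by (auto simp: parent_maps_def)
  have "set p \<noteq> {}" using p by (auto simp: cycle_def walk_def)
  then have "Max (d ` set p) \<in> d ` set p" by (intro Max_in) auto
  then obtain v where v: "v \<in> set p" "d v = Max (d ` set p)" by auto
  have max: "d x \<le> d v" if "x \<in> set p" for x using that v(2) by simp
  obtain x y where "x \<in> set p" "y \<in> set p" "x \<noteq> y"
    "{v, x} \<in> edges (parent_graph G S f)" "{v, y} \<in> edges (parent_graph G S f)"
    using cycle_two_neighbours[OF p v(1)] by blast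
  then show False
    using max d unfolding edge_parent_graph by (metis leD)
qed

text \<open>The root of a vertex is an invariant of its component: it does not change along an edge,
  and every element of \<open>S\<close> is its own root. This gives uniqueness of the root in each
  component.\<close>

lemma parent_graph_root:
  assumes "simple_graph G" "S \<subseteq> verts G" "f \<in> parent_maps G S"
  obtains root where
    "\<And>v. v \<in> verts G \<Longrightarrow> root v \<in> S \<and> (v, root v) \<in> (adj (parent_graph G S f))\<^sup>*"
    "\<And>v. v \<in> S \<Longrightarrow> root v = v"
    "\<And>u v. (u, v) \<in> (adj (parent_graph G S f))\<^sup>* \<Longrightarrow> root u = root v"
proof -
  obtain d :: "'a \<Rightarrow> nat" where d: "\<And>v. v \<in> verts G - S \<Longrightarrow> d (f v) < d v"
    using assms(3) by (auto simp: parent_maps_def)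
  have fV: "f v \<in> verts G" if "v \<in> verts G - S" for v
    using assms(3) that by (auto simp: parent_maps_def)
  have fin: "finite (verts G)" using assms(1) by (simp add: simple_graph_def)
  \<comment> \<open>Freezing the roots makes iteration total, and surplus iterations do no
    harm.\<close>
  define g where "g v = (if v \<in> S then v else f v)" for v
  have g_S: "(g ^^ n) v = v" if "v \<in> S" for n v
    using that by (induction n) (auto simp: g_def)
  have reach: "(g ^^ n) v \<in> S \<and> (v, (g ^^ n) v) \<in> (adj (parent_graph G S f))\<^sup>*"
    if "v \<in> verts G" "d v \<le> n" for n v
    using that
  proof (induction n arbitrary: v)
    case 0
    then have "v \<in> S" using d[of v] by auto
    then show ?case by simp
  next
    case (Suc n)
    show ?case
    proof (cases "v \<in> S")
      case True
      then show ?thesis using g_S[OF True, of "Suc n"] by (auto simp del: funpow.simps)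
    next
      case False
      then have "v \<in> verts G - S" using Suc by simp
      moreover from this have "(v, f v) \<in> adj (parent_graph G S f)"
        by (simp add: edge_parent_graph)
      moreover have "(g ^^ Suc n) v = (g ^^ n) (f v)"
        using False by (simp add: funpow_swap1 g_def)
      moreover have "d (f v) \<le> n" using d[of v] Suc False by simp
      ultimately show ?thesis
        using Suc.IH[of "f v"] fV[of v] by (metis converse_rtrancl_into_rtrancl)
    qed
  qed
  \<comment> \<open>\<open>M\<close> bounds every rank, so a single number of iterations brings all
    vertices into \<open>S\<close>.\<close>
  define M where "M = Max (d ` verts G)"
  define root where "root = g ^^ M"
  have root: "root v \<in> S \<and> (v, root v) \<in> (adj (parent_graph G S f))\<^sup>*" if "v \<in> verts G" for v
    using reach[OF that, of M] fin that by (auto simp: M_def root_def)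
  have root_f: "root (f v) = root v" if "v \<in> verts G - S" for v
  proof -
    \<comment> \<open>One extra step of \<open>g\<close> is absorbed because \<open>root v\<close>
      already lies in \<open>S\<close>, where \<open>g\<close> is the identity.\<close>
    have "root (f v) = (g ^^ Suc M) v" using that by (simp add: root_def funpow_swap1 g_def)
    also have "\<dots> = root v" using root[of v] that by (simp add: root_def g_def)
    finally show ?thesis .
  qed
  have root_adj: "root u = root v" if "(u, v) \<in> (adj (parent_graph G S f))\<^sup>*" for u v
    using that by induction (auto simp: edge_parent_graph root_f)
  show thesis
  proof (rule that)
    show "root v = v" if "v \<in> S" for v using g_S[OF that] by (simp add: root_def)
  qed (use root root_adj in auto)
qed

lemma rooted_spanning_forest_parent_graph:
  assumes "simple_graph G" "S \<subseteq> verts G" "f \<in> parent_maps G S"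
  shows "rooted_spanning_forest G S (parent_graph G S f)"
proof -
  let ?H = "parent_graph G S f"
  have sub: "subgraph ?H G" using assms subgraph_parent_graph by blast
  then have H: "simple_graph ?H" by (simp add: subgraph_def)
  obtain root where root:
    "\<And>v. v \<in> verts G \<Longrightarrow> root v \<in> S \<and> (v, root v) \<in> (adj ?H)\<^sup>*"
    "\<And>v. v \<in> S \<Longrightarrow> root v = v"
    "\<And>u v. (u, v) \<in> (adj ?H)\<^sup>* \<Longrightarrow> root u = root v"
    using parent_graph_root[OF assms] by blast
  have "\<exists>!s. joined ?H u s \<and> s \<in> S" if "u \<in> verts G" for u
  proof (rule ex1I[of _ "root u"])
    show "joined ?H u (root u) \<and> root u \<in> S"
      using root(1)[OF that] assms(2) by (auto simp: joined_iff_rtrancl[OF H])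
    show "s = root u" if "joined ?H u s \<and> s \<in> S" for s
      using that root by (metis joined_iff_rtrancl[OF H])
  qed
  then show ?thesis
    using sub acyclic_parent_graph[OF assms(3)]
    by (auto simp: rooted_spanning_forest_def spanning_forest_def graph_components_def)
qed

text \<open>If two parent maps with the same graph differ at \<open>v\<close>, they also differ at the parent of \<open>v\<close>,
  so following parents never reaches a root.\<close>

lemma inj_on_parent_graph: "inj_on (parent_graph G S) (parent_maps G S)"
proof (rule inj_onI)
  fix f g assume f: "f \<in> parent_maps G S" and g: "g \<in> parent_maps G S"
    and eq: "parent_graph G S f = parent_graph G S g"
  obtain d :: "'a \<Rightarrow> nat" where d: "\<And>v. v \<in> verts G - S \<Longrightarrow> d (g v) < d v"
    using g by (auto simp: parent_maps_def)
  have "f v = g v" if "v \<in> verts G - S" for v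
    using that
  proof (induction "d v" arbitrary: v rule: less_induct)
    case less
    show ?case
    proof (rule ccontr)
      assume ne: "f v \<noteq> g v"
      have "{v, g v} \<in> edges (parent_graph G S f)"
        unfolding eq using less.prems by (simp add: edge_parent_graph)
      then have gv: "g v \<in> verts G - S" "v = f (g v)"
        using ne by (auto simp: edge_parent_graph)
      have "g (g v) = v" using less.hyps[OF d[OF less.prems] gv(1)] gv(2) by simp
      then show False using d[OF less.prems] d[OF gv(1)] by simp
    qed
  qed
  then show "f = g"
    using f g by (intro PiE_ext[of f "verts G - S" "\<lambda>_. verts G" g]) (auto simp: parent_maps_def)
qed

section \<open>From rooted forests back to parent maps\<close>

lemma rooted_spanning_forest_reach:
  assumes "rooted_spanning_forest G S H" "u \<in> verts G"
  shows "\<exists>s\<in>S. (u, s) \<in> (adj H)\<^sup>*"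
    and "s \<in> S \<Longrightarrow> t \<in> S \<Longrightarrow> S \<subseteq> verts G \<Longrightarrow> (u, s) \<in> (adj H)\<^sup>* \<Longrightarrow> (u, t) \<in> (adj H)\<^sup>* \<Longrightarrow> s = t"
proof -
  have H: "simple_graph H" "verts H = verts G"
    using assms(1) by (auto simp: rooted_spanning_forest_def spanning_forest_def subgraph_def)
  have ex1: "\<exists>!s. joined H u s \<and> s \<in> S"
    using assms H(2) by (auto simp: rooted_spanning_forest_def graph_components_def)
  then show "\<exists>s\<in>S. (u, s) \<in> (adj H)\<^sup>*"
    using joined_iff_rtrancl[OF H(1)] by blast
  show "s = t" if "s \<in> S" "t \<in> S" "S \<subseteq> verts G" "(u, s) \<in> (adj H)\<^sup>*" "(u, t) \<in> (adj H)\<^sup>*"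
  proof -
    have "joined H u s" "joined H u t" using that H by (auto simp: joined_iff_rtrancl)
    then show ?thesis using ex1 that by blast
  qed
qed

text \<open>Every nonroot takes as parent a neighbour in \<open>H\<close> that is closer to
  \<open>S\<close>. The resulting graph lies in \<open>H\<close> and already links every vertex to a
  root, so any further edge of \<open>H\<close> would close a cycle.\<close>

lemma rooted_spanning_forest_imp_parent_graph:
  assumes S: "S \<subseteq> verts G" and rsf: "rooted_spanning_forest G S H"
  shows "H \<in> parent_graph G S ` parent_maps G S"
proof -
  have H: "simple_graph H" "verts H = verts G" "edges H \<subseteq> edges G" "acyclic_graph H"
    using rsf by (auto simp: rooted_spanning_forest_def spanning_forest_def subgraph_def)
  \<comment> \<open>\<open>D v\<close> is the distance from \<open>v\<close> to \<open>S\<close> in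
    \<open>H\<close>; it serves as the rank of the parent map.\<close>
  define D where "D v = (LEAST n. \<exists>s\<in>S. (v, s) \<in> adj H ^^ n)" for v
  have "\<exists>w. {v, w} \<in> edges H \<and> D w < D v" if v: "v \<in> verts G - S" for v
  proof -
    have "\<exists>n. \<exists>s\<in>S. (v, s) \<in> adj H ^^ n"
      using rooted_spanning_forest_reach(1)[OF rsf, of v] v rtrancl_imp_relpow by (metis DiffD1)
    then have "\<exists>s\<in>S. (v, s) \<in> adj H ^^ D v"
      unfolding D_def by (rule LeastI_ex)
    then obtain s where s: "s \<in> S" "(v, s) \<in> adj H ^^ D v" by blast
    then obtain m where m: "D v = Suc m" using v by (cases "D v") auto
    obtain w where w: "(v, w) \<in> adj H" "(w, s) \<in> adj H ^^ m"
      using s(2) unfolding m by (rule relpow_Suc_E2)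
    have "D w \<le> m" unfolding D_def by (rule Least_le) (use w s in blast)
    then show ?thesis using w(1) m by auto
  qed
  then obtain f' where f': "\<And>v. v \<in> verts G - S \<Longrightarrow> {v, f' v} \<in> edges H \<and> D (f' v) < D v"
    by metis
  define f where "f = restrict f' (verts G - S)"
  have fH: "{v, f v} \<in> edges H" if "v \<in> verts G - S" for v
    using f' that by (simp add: f_def)
  have f: "f \<in> parent_maps G S"
  proof -
    have "f v \<in> verts G" if "v \<in> verts G - S" for v
      using fH[OF that] H(1,2) unfolding simple_graph_def by blast
    then have "f \<in> (verts G - S) \<rightarrow>\<^sub>E verts G"
      by (auto simp: f_def)
    moreover have "\<exists>d :: 'a \<Rightarrow> nat. \<forall>v\<in>verts G - S. d (f v) < d v"
      by (intro exI[of _ D]) (simp add: f_def f')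
    ultimately show ?thesis using fH H(3) by (auto simp: parent_maps_def)
  qed
  let ?F = "parent_graph G S f"
  have FH: "edges ?F \<subseteq> edges H" using fH by (auto simp: parent_graph_def)
  have simF: "simple_graph ?F"
    using FH H(1,2) by (auto simp: simple_graph_def)
  have adjFH: "(adj ?F)\<^sup>* \<subseteq> (adj H)\<^sup>*" using FH by (intro rtrancl_mono) auto
  have "edges H \<subseteq> edges ?F"
  proof (rule subsetI, rule ccontr)
    fix e assume e: "e \<in> edges H" "e \<notin> edges ?F"
    then have "e \<subseteq> verts G \<and> card e = 2" using H(1,2) by (auto simp: simple_graph_def)
    then obtain u w where uw: "e = {u, w}" "u \<noteq> w" "u \<in> verts G" "w \<in> verts G"
      by (auto simp: card_2_iff)
    have uwH: "(u, w) \<in> (adj H)\<^sup>*" using e(1) uw(1) by auto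
    have reachF: "\<exists>s\<in>S. (v, s) \<in> (adj ?F)\<^sup>*" if "v \<in> verts G" for v
    proof -
      \<comment> \<open>Seen as a parent map of the simple graph \<open>H\<close>, \<open>f\<close>
        satisfies the hypotheses of \<open>parent_graph_root\<close>.\<close>
      have f'': "f \<in> parent_maps H S" "parent_graph H S f = ?F"
        using f fH H(2) by (auto simp: parent_maps_def parent_graph_def)
      show ?thesis
        using parent_graph_root[OF H(1) _ f''(1)] S H(2) that f''(2) by metis
    qed
    obtain s where s: "s \<in> S" "(u, s) \<in> (adj ?F)\<^sup>*" using reachF uw(3) by blast
    obtain t where t: "t \<in> S" "(w, t) \<in> (adj ?F)\<^sup>*" using reachF uw(4) by blast
    have "(u, t) \<in> (adj H)\<^sup>*" using uwH t(2) adjFH by (meson rtrancl_trans subsetD)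
    \<comment> \<open>The edge \<open>e\<close> puts \<open>u\<close> and \<open>w\<close> into one
      component of \<open>H\<close>, which has only one root. Through that root they are linked
      without using \<open>e\<close>.\<close>
    then have "s = t"
      using rooted_spanning_forest_reach(2)[OF rsf uw(3) s(1) t(1) S] s(2) adjFH by blast
    then have "(u, w) \<in> (adj ?F)\<^sup>*"
      using s(2) t(2) adj_rtrancl_sym by (metis rtrancl_trans)
    then obtain p where p: "walk ?F p" "distinct p" "hd p = u" "last p = w"
      using rtrancl_imp_distinct_walk[OF simF] uw(4) by auto
    \<comment> \<open>One vertex would force \<open>u = w\<close>, and two would make
      \<open>e\<close> an edge of the parent graph.\<close>
    have "length p \<ge> 3"
    proof (rule ccontr)
      assume "\<not> ?thesis"
      moreover have "p \<noteq> []" using p(1) by (simp add: walk_def)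
      ultimately consider x where "p = [x]" | x y where "p = [x, y]"
        by (cases p; cases "tl p"; cases "tl (tl p)") auto
      then show False
        using p e(2) uw by cases (auto simp: walk_Cons)
    qed
    moreover have "walk H p" using p(1) FH H(2) by (auto simp: walk_def)
    moreover have "{last p, hd p} \<in> edges H" using e(1) uw(1) p by (simp add: insert_commute)
    ultimately have "cycle H p" using p(2) by (simp add: cycle_def)
    then show False using H(4) by (auto simp: acyclic_graph_def)
  qed
  then have "H = ?F"
    using FH H(2) by (intro ugraph.equality) auto
  then show ?thesis using f by blast
qed

theorem num_rooted_forests_eq_card_parent_maps:
  assumes "simple_graph G" "S \<subseteq> verts G"
  shows "num_rooted_forests G S = card (parent_maps G S)"
proof -
  have "{H. rooted_spanning_forest G S H} = parent_graph G S ` parent_maps G S"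
    using rooted_spanning_forest_parent_graph[OF assms]
      rooted_spanning_forest_imp_parent_graph[OF assms(2)] by auto
  then show ?thesis
    by (simp add: num_rooted_forests_def card_image[OF inj_on_parent_graph])
qed


section \<open>Counting words\<close>

datatype direction = At_Root | To_Prev | To_Next | To_Center

text \<open>Roots are recorded as letters too, so a root automatically separates
  \<open>To_Next\<close> from \<open>To_Prev\<close>. Nothing links the last letter to the first:
  the rim will be cut so that position 0 is a root, and no obstruction is lost there.\<close>

definition words :: "nat set \<Rightarrow> nat \<Rightarrow> direction list set" where
  "words T n = {w. length w = n \<and> (\<forall>i<n. w ! i = At_Root \<longleftrightarrow> i \<in> T) \<and>
     (\<forall>i. Suc i < n \<longrightarrow> \<not> (w ! i = To_Next \<and> w ! Suc i = To_Prev))}"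

text \<open>These are the words that cannot be continued by \<open>To_Prev\<close>, the second
  quantity in the recursion.\<close>

definition next_words :: "nat set \<Rightarrow> nat \<Rightarrow> direction list set" where
  "next_words T n = {w \<in> words T n. w \<noteq> [] \<and> last w = To_Next}"

lemma finite_words [simp]: "finite (words T n)"
proof (rule finite_subset)
  have "(UNIV :: direction set) = {At_Root, To_Prev, To_Next, To_Center}"
    by (auto intro: direction.exhaust)
  then have "finite (UNIV :: direction set)" by (metis finite.emptyI finite.insertI)
  then show "finite {w :: direction list. set w \<subseteq> UNIV \<and> length w = n}"
    by (rule finite_lists_length_eq)
qed (auto simp: words_def)

lemma words_0 [simp]: "words T 0 = {[]}"
  by (auto simp: words_def)

text \<open>Appending \<open>x\<close> creates only one new adjacent pair, formed by the last letter
  of \<open>w\<close> and \<open>x\<close>. If \<open>w\<close> has the wrong length, both sides are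
  false.\<close>

lemma snoc_in_words:
  "w @ [x] \<in> words T (Suc n) \<longleftrightarrow>
     w \<in> words T n \<and> (x = At_Root \<longleftrightarrow> n \<in> T) \<and> (x = To_Prev \<longrightarrow> w \<notin> next_words T n)"
proof (cases "length w = n")
  case True
  have "(\<forall>i. Suc i < Suc n \<longrightarrow> \<not> ((w @ [x]) ! i = To_Next \<and> (w @ [x]) ! Suc i = To_Prev)) \<longleftrightarrow>
        (\<forall>i. Suc i < n \<longrightarrow> \<not> (w ! i = To_Next \<and> w ! Suc i = To_Prev)) \<and>
        (x = To_Prev \<longrightarrow> \<not> (w \<noteq> [] \<and> last w = To_Next))" (is "?A \<longleftrightarrow> ?B \<and> ?C")
  proof (cases n)
    case 0
    then show ?thesis using True by simp
  next
    case (Suc m)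
    have "?A \<longleftrightarrow> ?B \<and> \<not> (w ! m = To_Next \<and> x = To_Prev)"
      using True Suc by (auto simp: nth_append less_Suc_eq)
    moreover have "w \<noteq> []" using True Suc by auto
    moreover from this have "last w = w ! m" using True Suc by (simp add: last_conv_nth)
    ultimately show ?thesis by auto
  qed
  moreover have "(\<forall>i<Suc n. (w @ [x]) ! i = At_Root \<longleftrightarrow> i \<in> T) \<longleftrightarrow>
      (\<forall>i<n. w ! i = At_Root \<longleftrightarrow> i \<in> T) \<and> (x = At_Root \<longleftrightarrow> n \<in> T)"
    using True by (auto simp: nth_append less_Suc_eq)
  ultimately show ?thesis
    using True unfolding words_def next_words_def by auto
qed (auto simp: words_def)

lemma words_Suc_iff:
  "w \<in> words T (Suc n) \<longleftrightarrow> (\<exists>v x. w = v @ [x] \<and>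
     v \<in> words T n \<and> (x = At_Root \<longleftrightarrow> n \<in> T) \<and> (x = To_Prev \<longrightarrow> v \<notin> next_words T n))"
proof (cases w rule: rev_cases)
  case Nil
  then show ?thesis by (simp add: words_def)
next
  case (snoc v x)
  then show ?thesis by (simp add: snoc_in_words)
qed

lemma card_snoc: "card ((\<lambda>w. w @ [x]) ` A) = card A"
  by (intro card_image inj_onI) simp

lemma card_words_Suc_root:
  assumes "n \<in> T"
  shows "card (words T (Suc n)) = card (words T n)" "card (next_words T (Suc n)) = 0"
proof -
  have "words T (Suc n) = (\<lambda>w. w @ [At_Root]) ` words T n"
    using assms by (auto simp: words_Suc_iff)
  then show "card (words T (Suc n)) = card (words T n)"
    by (simp add: card_snoc)
  have "next_words T (Suc n) = {}"
    using assms by (auto simp: next_words_def words_Suc_iff)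
  then show "card (next_words T (Suc n)) = 0" by simp
qed

text \<open>All three nonroot letters can follow any word, except \<open>To_Prev\<close> after a
  word ending in \<open>To_Next\<close>. Stated as a sum, the recursion avoids truncated
  subtraction.\<close>

lemma card_words_Suc_nonroot:
  assumes "n \<notin> T"
  shows "card (words T (Suc n)) + card (next_words T n) = 3 * card (words T n)"
    and "card (next_words T (Suc n)) = card (words T n)"
proof -
  have sub: "next_words T n \<subseteq> words T n" by (auto simp: next_words_def)
  have "words T (Suc n) = (\<lambda>w. w @ [To_Prev]) ` (words T n - next_words T n) \<union>
      (\<lambda>w. w @ [To_Next]) ` words T n \<union> (\<lambda>w. w @ [To_Center]) ` words T n" (is "_ = ?A \<union> ?B \<union> ?C")
  proof (intro equalityI subsetI)
    fix w assume "w \<in> words T (Suc n)"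
    then obtain v x where vx: "w = v @ [x]" "v \<in> words T n" "x \<noteq> At_Root"
        "x = To_Prev \<longrightarrow> v \<notin> next_words T n"
      using assms by (auto simp: words_Suc_iff)
    then show "w \<in> ?A \<union> ?B \<union> ?C" by (cases x) auto
  qed (use assms in \<open>auto simp: words_Suc_iff\<close>)
  moreover have "card (?A \<union> ?B \<union> ?C) = card ?A + card ?B + card ?C"
    by (subst card_Un_disjoint; (subst card_Un_disjoint)?) auto
  ultimately have "card (words T (Suc n)) = card (words T n - next_words T n) + 2 * card (words T n)"
    by (simp add: card_snoc)
  moreover have "card (next_words T n) \<le> card (words T n)"
    using sub by (simp add: card_mono)
  ultimately show "card (words T (Suc n)) + card (next_words T n) = 3 * card (words T n)"
    using sub by (simp add: card_Diff_subset finite_subset)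
  have "next_words T (Suc n) = (\<lambda>w. w @ [To_Next]) ` words T n"
    using assms by (auto simp: next_words_def words_Suc_iff)
  then show "card (next_words T (Suc n)) = card (words T n)"
    by (simp add: card_snoc)
qed

text \<open>Reading the root at \<open>n\<close> leaves the counts \<open>W\<close> and 0, that is
  \<open>W\<close> times \<open>fib 2\<close> and \<open>fib 0\<close>. From there the nonroot
  recursion moves the pair along the even-indexed Fibonacci numbers.\<close>

lemma card_words_gap:
  assumes "n \<in> T" "\<And>j. 0 < j \<Longrightarrow> j < Suc k \<Longrightarrow> n + j \<notin> T"
  shows "card (words T (n + Suc k)) = card (words T n) * fib (2 * Suc k) \<and>
         card (next_words T (n + Suc k)) = card (words T n) * fib (2 * k)"
  using assms(2)
proof (induction k)
  case 0
  then show ?case using card_words_Suc_root[OF assms(1)] by (simp add: numeral_2_eq_2)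
next
  case (Suc k)
  let ?m = "n + Suc k" and ?W = "card (words T n)"
  have "?m \<notin> T" using Suc.prems[of "Suc k"] by simp
  note rec = card_words_Suc_nonroot[OF this]
  have IH: "card (words T ?m) = ?W * fib (2 * Suc k)" "card (next_words T ?m) = ?W * fib (2 * k)"
    using Suc.IH Suc.prems by auto
  \<comment> \<open>The even-indexed Fibonacci numbers satisfy the same recursion as the
    words.\<close>
  have "fib (2 * Suc (Suc k)) + fib (2 * k) = 3 * fib (2 * Suc k)" by simp
  then have "?W * fib (2 * Suc (Suc k)) + ?W * fib (2 * k) = 3 * (?W * fib (2 * Suc k))"
    by (metis distrib_left mult.left_commute)
  then show ?case using rec IH by (simp del: fib.simps mult_Suc_right)
qed

text \<open>Each gap begins at a root and so multiplies the count by its own factor. The endpoint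
  \<open>s r\<close> closes the last gap and is not itself read as a letter.\<close>

lemma card_words:
  assumes "s 0 = 0" and "\<And>i. i < r \<Longrightarrow> s i < s (Suc i)" and "\<And>i. i < r \<Longrightarrow> s i \<in> T"
    and "\<And>i t. i < r \<Longrightarrow> s i < t \<Longrightarrow> t < s (Suc i) \<Longrightarrow> t \<notin> T"
  shows "card (words T (s r)) = (\<Prod>i<r. fib (2 * (s (Suc i) - s i)))"
  using assms(2-4)
proof (induction r)
  case 0
  then show ?case by (simp add: assms(1))
next
  case (Suc r)
  define k where "k = s (Suc r) - s r - 1"
  have k: "s (Suc r) = s r + Suc k" using Suc.prems(1)[of r] by (simp add: k_def)
  have "card (words T (s (Suc r))) = card (words T (s r)) * fib (2 * Suc k)"
    unfolding k using Suc.prems(2)[of r] Suc.prems(3)[of r] k by (intro card_words_gap[THEN conjunct1]) auto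
  also have "card (words T (s r)) = (\<Prod>i<r. fib (2 * (s (Suc i) - s i)))"
    using Suc.IH Suc.prems less_SucI by metis
  also have "Suc k = s (Suc r) - s r" using k by simp
  finally show ?case by simp
qed


section \<open>Parent maps of the wheel\<close>

text \<open>Position \<open>t\<close> is reached by \<open>t\<close> steps along the rim from the
  vertex at position 0. Since \<open>t\<close> is any natural number, position \<open>N\<close> is
  position 0 again and the successor is always \<open>Suc t\<close>.\<close>

definition rotated_rim :: "nat \<Rightarrow> nat \<Rightarrow> nat \<Rightarrow> wheel_vertex" where
  "rotated_rim N b t = Rim ((b + t) mod N + 1)"

lemma rotated_rim_neq_Center [simp]: "rotated_rim N b t \<noteq> Center" "Center \<noteq> rotated_rim N b t"
  by (simp_all add: rotated_rim_def)

lemma rotated_rim_eq_iff: "rotated_rim N b s = rotated_rim N b t \<longleftrightarrow> s mod N = t mod N"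
  using cong_add_lcancel_nat[of b s t N] by (simp add: rotated_rim_def cong_def)

lemma rotated_rim_in_rim: "N > 0 \<Longrightarrow> rotated_rim N b t \<in> rim N"
  by (simp add: rotated_rim_def rim_def Suc_le_eq)

lemma inj_on_rotated_rim: "inj_on (rotated_rim N b) {..<N}"
  by (auto simp: inj_on_def rotated_rim_eq_iff)

lemma image_rotated_rim: "rotated_rim N b ` {..<N} = rim N"
proof (rule card_subset_eq)
  show "rotated_rim N b ` {..<N} \<subseteq> rim N"
    by (auto intro!: rotated_rim_in_rim)
  show "card (rotated_rim N b ` {..<N}) = card (rim N)"
    by (simp add: card_image[OF inj_on_rotated_rim] rim_def card_image inj_on_def)
qed (simp add: rim_def)

text \<open>Letting \<open>t\<close> range over all naturals only repeats edges, and in exchange the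
  wrap-around needs no separate case.\<close>

lemma edges_wheel:
  assumes "N > 0"
  shows "edges (wheel N) =
    range (\<lambda>t. {rotated_rim N b t, rotated_rim N b (Suc t)}) \<union> range (\<lambda>t. {Center, rotated_rim N b t})"
proof -
  have succ: "Rim (i mod N + 1) = rotated_rim N b (Suc t)" if "Rim i = rotated_rim N b t" for i t
    using that by (simp add: rotated_rim_def mod_Suc_eq)
  have pos: "\<exists>t. Rim i = rotated_rim N b t" if "i \<in> {1..N}" for i
  proof -
    have "Rim i \<in> rotated_rim N b ` {..<N}" using that by (simp add: image_rotated_rim rim_def)
    then show ?thesis by auto
  qed
  have idx: "\<exists>i\<in>{1..N}. Rim i = rotated_rim N b t" for t
    using rotated_rim_in_rim[OF assms, of b t] by (auto simp: rim_def)
  show ?thesis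
    unfolding wheel_def ugraph.simps
  proof (intro arg_cong2[of _ _ _ _ "(\<union>)"] equalityI subsetI)
    fix e assume "e \<in> {{Rim i, Rim (i mod N + 1)} | i. i \<in> {1..N}}"
    then obtain i where i: "i \<in> {1..N}" "e = {Rim i, Rim (i mod N + 1)}" by blast
    obtain t where "Rim i = rotated_rim N b t" using pos[OF i(1)] by blast
    then show "e \<in> range (\<lambda>t. {rotated_rim N b t, rotated_rim N b (Suc t)})"
      using i(2) succ by auto
  next
    fix e assume "e \<in> range (\<lambda>t. {rotated_rim N b t, rotated_rim N b (Suc t)})"
    then obtain t where t: "e = {rotated_rim N b t, rotated_rim N b (Suc t)}" by blast
    obtain i where "i \<in> {1..N}" "Rim i = rotated_rim N b t" using idx[of t] by blast
    then show "e \<in> {{Rim i, Rim (i mod N + 1)} | i. i \<in> {1..N}}"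
      using t succ[of i t] by (intro CollectI exI[of _ i]) simp
  next
    fix e assume "e \<in> {{Center, Rim i} | i. i \<in> {1..N}}"
    then obtain i where i: "i \<in> {1..N}" "e = {Center, Rim i}" by blast
    then show "e \<in> range (\<lambda>t. {Center, rotated_rim N b t})" using pos[OF i(1)] by auto
  next
    fix e assume "e \<in> range (\<lambda>t. {Center, rotated_rim N b t})"
    then obtain t where t: "e = {Center, rotated_rim N b t}" by blast
    obtain i where "i \<in> {1..N}" "Rim i = rotated_rim N b t" using idx[of t] by blast
    then show "e \<in> {{Center, Rim i} | i. i \<in> {1..N}}"
      using t by (intro CollectI exI[of _ i]) simp
  qed
qed

lemma wheel_neighbours:
  assumes "N > 0" "t > 0"
  shows "{rotated_rim N b t, x} \<in> edges (wheel N) \<longleftrightarrow>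
    x = Center \<or> x = rotated_rim N b (Suc t) \<or> x = rotated_rim N b (t - 1)" (is "?L \<longleftrightarrow> ?R")
proof
  \<comment> \<open>Passing to the cyclic successor is injective, since 1 can be cancelled modulo
    \<open>N\<close>.\<close>
  have Suc_eq: "rotated_rim N b (Suc s) = rotated_rim N b (Suc t) \<longleftrightarrow> rotated_rim N b s = rotated_rim N b t"
    for s t
    using cong_add_rcancel_nat[of s 1 t N] by (simp add: rotated_rim_eq_iff cong_def)
  obtain u where u: "t = Suc u" using assms(2) by (cases t) auto
  assume ?L
  then consider (Center) "x = Center"
    | (Next) s where "rotated_rim N b s = rotated_rim N b t" "x = rotated_rim N b (Suc s)"
    | (Prev) s where "rotated_rim N b (Suc s) = rotated_rim N b t" "x = rotated_rim N b s"
    unfolding edges_wheel[OF assms(1), of b] by (auto simp: doubleton_eq_iff)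
  then show ?R
  proof cases
    case (Next s)
    then show ?thesis by (simp add: Suc_eq)
  next
    case (Prev s)
    then show ?thesis by (simp add: u Suc_eq)
  qed simp
next
  assume ?R
  moreover have "{rotated_rim N b t, rotated_rim N b (t - 1)} =
      {rotated_rim N b (t - 1), rotated_rim N b (Suc (t - 1))}"
    using assms(2) by (simp add: insert_commute)
  ultimately show ?L
    unfolding edges_wheel[OF assms(1), of b] by (auto simp: insert_commute)
qed

section \<open>Words as codes for the parent maps of the wheel\<close>

fun target :: "nat \<Rightarrow> nat \<Rightarrow> nat \<Rightarrow> direction \<Rightarrow> wheel_vertex" where
  "target N b t To_Prev = rotated_rim N b (t - 1)"
| "target N b t To_Next = rotated_rim N b (Suc t)"
| "target N b t To_Center = Center"
| "target N b t At_Root = undefined"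

text \<open>With at least three rim vertices, predecessor and successor differ. If
  \<open>Suc t = N\<close>, the successor wraps to position 0 while the predecessor is at position
  \<open>N - 2\<close>.\<close>

lemma target_inject:
  assumes "N \<ge> 3" "0 < t" "t < N" "x \<noteq> At_Root" "y \<noteq> At_Root" "target N b t x = target N b t y"
  shows "x = y"
proof -
  have "rotated_rim N b (t - 1) \<noteq> rotated_rim N b (Suc t)"
    using assms(1-3) by (cases "Suc t = N") (auto simp: rotated_rim_eq_iff)
  then show ?thesis using assms(4-6) by (cases x; cases y) auto
qed

text \<open>\<open>inv_into\<close> recovers the position of \<open>v\<close> below
  \<open>N\<close>. The restriction makes the map extensional and keeps the arbitrary value of
  \<open>target\<close> at \<open>At_Root\<close> out of it.\<close>

definition word_parent :: "nat \<Rightarrow> nat \<Rightarrow> wheel_vertex set \<Rightarrow> direction list \<Rightarrow> wheel_vertex \<Rightarrow> wheel_vertex" where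
  "word_parent N b A w = restrict
     (\<lambda>v. let t = inv_into {..<N} (rotated_rim N b) v in target N b t (w ! t)) (rim N - A)"

lemma word_parent_rotated_rim:
  assumes "t < N" "rotated_rim N b t \<notin> A"
  shows "word_parent N b A w (rotated_rim N b t) = target N b t (w ! t)"
  using assms rotated_rim_in_rim[of N b t]
  by (simp add: word_parent_def inv_into_f_f[OF inj_on_rotated_rim])

lemma wheel_nonroots: "verts (wheel N) - insert Center A = rim N - A"
  by (auto simp: wheel_def rim_def)

lemma rim_cases:
  assumes "v \<in> rim N"
  obtains t where "t < N" "v = rotated_rim N b t"
  using assms image_rotated_rim[of N b] by auto

text \<open>Since position \<open>0\<close> is a root, chains of \<open>To_Prev\<close> and \<open>To_Next\<close> never pass it, so ranks
  increasing along \<open>To_Prev\<close> chains and decreasing along \<open>To_Next\<close> chains are globally consistent.\<close>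

lemma word_parent_in_parent_maps:
  assumes N: "N \<ge> 3" and root: "rotated_rim N b 0 \<in> A" and w: "w \<in> words {t. rotated_rim N b t \<in> A} N"
  shows "word_parent N b A w \<in> parent_maps (wheel N) (insert Center A)"
proof -
  let ?\<rho> = "rotated_rim N b" and ?f = "word_parent N b A w"
  have wr: "w ! t = At_Root \<longleftrightarrow> ?\<rho> t \<in> A" if "t < N" for t
    using w that by (auto simp: words_def)
  have wpn: "\<not> (w ! t = To_Next \<and> w ! Suc t = To_Prev)" if "Suc t < N" for t
    using w that by (auto simp: words_def)
  define rk where "rk t = (case w ! t of At_Root \<Rightarrow> 0 | To_Center \<Rightarrow> 1 | To_Prev \<Rightarrow> t + 1
    | To_Next \<Rightarrow> N + 1 - t)" for t
  define d where "d v = (if v = Center then 0 else rk (inv_into {..<N} ?\<rho> v))" for v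
  have d: "d (?\<rho> t) = rk t" if "t < N" for t
    using that by (simp add: d_def inv_into_f_f[OF inj_on_rotated_rim])
  have last: "?\<rho> N = ?\<rho> 0" by (simp add: rotated_rim_eq_iff)
  have rk0: "rk 0 = 0" using wr[of 0] root N by (simp add: rk_def)
  have key: "?f (?\<rho> t) \<in> verts (wheel N) \<and> {?\<rho> t, ?f (?\<rho> t)} \<in> edges (wheel N) \<and> d (?f (?\<rho> t)) < d (?\<rho> t)"
    if t: "t < N" "?\<rho> t \<notin> A" for t
  proof -
    have "t \<noteq> 0" using t root by (intro notI) simp
    then have t0: "t > 0" by simp
    have f: "?f (?\<rho> t) = target N b t (w ! t)" using t by (simp add: word_parent_rotated_rim)
    have "w ! t \<noteq> At_Root" using wr t by simp
    then have edge: "{?\<rho> t, ?f (?\<rho> t)} \<in> edges (wheel N)"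
      unfolding f using wheel_neighbours[of N t b] N t0 by (cases "w ! t") auto
    moreover have "?f (?\<rho> t) \<in> verts (wheel N)"
      using edge simple_graph_wheel[OF N] unfolding simple_graph_def by blast
    moreover have "d (?f (?\<rho> t)) < d (?\<rho> t)"
    proof (cases "w ! t")
      case At_Root
      then show ?thesis using wr t by simp
    next
      case To_Center
      then show ?thesis unfolding f d[OF t(1)] by (simp add: d_def rk_def)
    next
      case To_Prev
      have "w ! (t - 1) \<noteq> To_Next" using wpn[of "t - 1"] t t0 To_Prev by auto
      \<comment> \<open>The predecessor has rank 0 if it is a root, 1 if it chooses the center, and
        \<open>t\<close> if it chooses its own predecessor.\<close>
      then have "rk (t - 1) < t + 1"
        using t0 by (cases "w ! (t - 1)") (auto simp: rk_def)
      then show ?thesis unfolding f d[OF t(1)] using t To_Prev by (simp add: d rk_def)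
    next
      case To_Next
      have "d (?\<rho> (Suc t)) < N + 1 - t"
      \<comment> \<open>The successor of the last position is position 0, a root of rank 0.\<close>
      proof (cases "Suc t = N")
        case True
        then show ?thesis using last d[of 0] rk0 N by simp
      next
        case False
        then have "w ! Suc t \<noteq> To_Prev" "Suc t < N" using wpn[of t] t To_Next by auto
        then show ?thesis by (cases "w ! Suc t") (auto simp: d rk_def)
      qed
      then show ?thesis unfolding f d[OF t(1)] using To_Next by (simp add: rk_def)
    qed
    ultimately show ?thesis by blast
  qed
  then have key': "?f v \<in> verts (wheel N) \<and> {v, ?f v} \<in> edges (wheel N) \<and> d (?f v) < d v"
    if "v \<in> rim N - A" for v
    using that by (metis DiffE rim_cases)
  then show ?thesis
    unfolding parent_maps_def wheel_nonroots by (auto simp: word_parent_def)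
qed

lemma inj_on_word_parent:
  assumes N: "N \<ge> 3" and root: "rotated_rim N b 0 \<in> A"
  shows "inj_on (word_parent N b A) (words {t. rotated_rim N b t \<in> A} N)"
proof (rule inj_onI)
  let ?\<rho> = "rotated_rim N b"
  fix w w' assume w: "w \<in> words {t. ?\<rho> t \<in> A} N" and w': "w' \<in> words {t. ?\<rho> t \<in> A} N"
    and eq: "word_parent N b A w = word_parent N b A w'"
  show "w = w'"
  proof (rule nth_equalityI)
    show "length w = length w'" using w w' by (simp add: words_def)
    fix t assume "t < length w"
    then have t: "t < N" using w by (simp add: words_def)
    have wr: "w ! t = At_Root \<longleftrightarrow> ?\<rho> t \<in> A" "w' ! t = At_Root \<longleftrightarrow> ?\<rho> t \<in> A"
      using w w' t by (auto simp: words_def)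
    show "w ! t = w' ! t"
    proof (cases "?\<rho> t \<in> A")
      case True
      then show ?thesis using wr by simp
    next
      case False
      then have "t \<noteq> 0" using root by (intro notI) simp
      moreover have "target N b t (w ! t) = target N b t (w' ! t)"
        using eq word_parent_rotated_rim[OF t False] by metis
      ultimately show ?thesis using target_inject[OF N _ t] wr False by blast
    qed
  qed
qed

text \<open>The word is read off from \<open>f\<close>: the parent of a nonroot rim vertex is one of
  its three neighbours, and each neighbour has a letter.\<close>

lemma parent_map_is_word_parent:
  assumes N: "N \<ge> 3" and root: "rotated_rim N b 0 \<in> A"
    and f: "f \<in> parent_maps (wheel N) (insert Center A)"
  shows "f \<in> word_parent N b A ` words {t. rotated_rim N b t \<in> A} N"
proof -
  let ?\<rho> = "rotated_rim N b"
  have ext: "f \<in> extensional (rim N - A)"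
    and edge: "\<And>v. v \<in> rim N - A \<Longrightarrow> {v, f v} \<in> edges (wheel N)"
    using f unfolding parent_maps_def wheel_nonroots by (auto simp: PiE_def)
  obtain d :: "wheel_vertex \<Rightarrow> nat" where d: "\<And>v. v \<in> rim N - A \<Longrightarrow> d (f v) < d v"
    using f unfolding parent_maps_def wheel_nonroots by auto
  have nonroot: "?\<rho> t \<in> rim N - A" if "?\<rho> t \<notin> A" for t
    using that rotated_rim_in_rim[of N b t] N by simp
  \<comment> \<open>\<open>To_Prev\<close> is the default letter; \<open>wt\<close> confirms that
    the predecessor is the only parent left in that case.\<close>
  define w where "w = map (\<lambda>t. if ?\<rho> t \<in> A then At_Root else if f (?\<rho> t) = Center then To_Center
     else if f (?\<rho> t) = ?\<rho> (Suc t) then To_Next else To_Prev) [0..<N]"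
  have wt: "target N b t (w ! t) = f (?\<rho> t)" if t: "t < N" "?\<rho> t \<notin> A" for t
  proof -
    have "t \<noteq> 0" using t root by (intro notI) simp
    then have "f (?\<rho> t) = Center \<or> f (?\<rho> t) = ?\<rho> (Suc t) \<or> f (?\<rho> t) = ?\<rho> (t - 1)"
      using edge[OF nonroot[OF t(2)]] wheel_neighbours[of N t b] N by simp
    then show ?thesis using t by (auto simp: w_def)
  qed
  have wr: "w ! t = At_Root \<longleftrightarrow> ?\<rho> t \<in> A" if "t < N" for t
    using that by (simp add: w_def)
  \<comment> \<open>Such a pair would consist of two vertices that are each other's parent, and the
    rank would drop in both directions.\<close>
  have "\<not> (w ! t = To_Next \<and> w ! Suc t = To_Prev)" if t: "Suc t < N" for t
  proof
    assume a: "w ! t = To_Next \<and> w ! Suc t = To_Prev"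
    then have nr: "?\<rho> t \<notin> A" "?\<rho> (Suc t) \<notin> A" using wr[of t] wr[of "Suc t"] t by auto
    then have "f (?\<rho> t) = ?\<rho> (Suc t)" "f (?\<rho> (Suc t)) = ?\<rho> t"
      using wt[of t] wt[of "Suc t"] a t by auto
    then show False using d[OF nonroot[OF nr(1)]] d[OF nonroot[OF nr(2)]] by simp
  qed
  then have "w \<in> words {t. ?\<rho> t \<in> A} N"
    using wr by (simp add: words_def) (simp add: w_def)
  moreover have "f = word_parent N b A w"
  proof (rule extensionalityI[OF ext])
    show "word_parent N b A w \<in> extensional (rim N - A)" by (simp add: word_parent_def)
    fix v assume v: "v \<in> rim N - A"
    then obtain t where "t < N" "v = ?\<rho> t" using rim_cases by blast
    then show "f v = word_parent N b A w v"
      using v wt[of t] word_parent_rotated_rim[of t N b A w] by simp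
  qed
  ultimately show ?thesis by blast
qed

lemma num_rooted_forests_wheel:
  assumes N: "N \<ge> 3" and A: "A \<subseteq> rim N" and root: "rotated_rim N b 0 \<in> A"
  shows "num_rooted_forests (wheel N) (insert Center A) = card (words {t. rotated_rim N b t \<in> A} N)"
proof -
  have "num_rooted_forests (wheel N) (insert Center A) = card (parent_maps (wheel N) (insert Center A))"
    using A by (intro num_rooted_forests_eq_card_parent_maps simple_graph_wheel[OF N])
      (auto simp: wheel_def)
  also have "parent_maps (wheel N) (insert Center A) =
      word_parent N b A ` words {t. rotated_rim N b t \<in> A} N"
    using word_parent_in_parent_maps[OF N root] parent_map_is_word_parent[OF N root] by blast
  also have "card \<dots> = card (words {t. rotated_rim N b t \<in> A} N)"
    by (rule card_image[OF inj_on_word_parent[OF N root]])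
  finally show ?thesis .
qed

theorem theorem1p2:
  fixes N r :: nat and R :: "wheel_vertex set"
  assumes "N \<ge> 3" and "1 \<le> r" and "r \<le> N"
    and "R \<subseteq> rim N" and "card R = r"
  shows "num_rooted_forests (wheel N) ({Center} \<union> R) = (\<Prod>i=1..r. fib (2 * cyclic_interval N R i))"
proof -
  define a where "a = rim_index R"
  note mono = rim_index(1)[OF assms(4), folded a_def, unfolded assms(5)]
  note R = rim_index(2)[OF assms(4), folded a_def, unfolded assms(5)]
  have a_less: "a i < a j" if "1 \<le> i" "i < j" "j \<le> r" for i j
    using mono that by (auto simp: strict_mono_on_def)
  have a_le: "a i \<le> a j" if "1 \<le> i" "i \<le> j" "j \<le> r" for i j
    using a_less[of i j] that by (cases "i = j") auto
  have aR: "Rim (a i) \<in> R" if "1 \<le> i" "i \<le> r" for i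
    using that by (subst R) simp
  have a_range: "1 \<le> a i \<and> a i \<le> N" if "1 \<le> i" "i \<le> r" for i
    using aR[OF that] assms(4) by (auto simp: rim_def)
  \<comment> \<open>This offset puts the first root, with index \<open>a 1\<close>, at position
    0.\<close>
  define b where "b = a 1 - 1"
  have a1: "a 1 = Suc b" using a_range[of 1] assms(2) by (simp add: b_def)
  let ?\<rho> = "rotated_rim N b"
  \<comment> \<open>For \<open>k < r\<close>, \<open>s k\<close> is the position of the root with
    index \<open>a (Suc k)\<close>. The final value \<open>N\<close> closes the circle, so that the
    last gap is \<open>a 1 + N - a r\<close>.\<close>
  define s where "s k = (if k < r then a (Suc k) - a 1 else N)" for k
  have \<rho>: "?\<rho> (s k) = Rim (a (Suc k))" if "k < r" for k
  proof -
    have "Suc (b + s k) = a (Suc k)"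
      using that a_le[of 1 "Suc k"] a1 by (simp add: s_def)
    moreover from this have "b + s k < N" using a_range[of "Suc k"] that by simp
    ultimately show ?thesis by (simp add: rotated_rim_def)
  qed
  have s0: "s 0 = 0" using assms(2) by (simp add: s_def)
  have root: "?\<rho> 0 \<in> R" using \<rho>[of 0] s0 aR[of 1] assms(2) by simp
  have s_diff: "s (Suc i) - s i = cyclic_interval N R (Suc i)" if "i < r" for i
  proof (cases "Suc i < r")
    case True
    then show ?thesis
      using a_le[of 1 "Suc i"] by (simp add: s_def cyclic_interval_def assms(5) a_def)
  next
    case False
    then have "r = Suc i" using that by simp
    then show ?thesis
      using a_le[of 1 "Suc i"] a_range[of "Suc i"]
      by (simp add: s_def cyclic_interval_def assms(5) flip: a_def)
  qed
  have "card (words {t. ?\<rho> t \<in> R} (s r)) = (\<Prod>i<r. fib (2 * (s (Suc i) - s i)))"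
  proof (rule card_words[of s, OF s0])
    show "s i \<in> {t. ?\<rho> t \<in> R}" if "i < r" for i
      using \<rho>[OF that] aR[of "Suc i"] that by simp
    show "s i < s (Suc i)" if "i < r" for i
      using a_less[of "Suc i" "Suc (Suc i)"] a_le[of 1 "Suc i"] a_range[of "Suc i"] a1 that
      by (auto simp: s_def)
    \<comment> \<open>Before the wrap-around, a root inside a gap would lie strictly between two
      consecutive root indices or beyond the last one. After the wrap-around its index would be
      smaller than the least index \<open>a 1\<close>.\<close>
    show "t \<notin> {t. ?\<rho> t \<in> R}" if i: "i < r" and t: "s i < t" "t < s (Suc i)" for i t
    proof
      assume "t \<in> {t. ?\<rho> t \<in> R}"
      then have "?\<rho> t \<in> R" by simp
      then obtain j where j: "1 \<le> j" "j \<le> r" "(b + t) mod N + 1 = a j"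
        using R by (auto simp: rotated_rim_def)
      have tN: "t < N" using t a_range[of "Suc (Suc i)"] by (auto simp: s_def split: if_splits)
      have bN: "b < N" using a_range[of 1] a1 assms(2) by simp
      show False
      proof (cases "b + t < N")
        case True
        then have aj: "a j = a 1 + t" using j a1 by simp
        then have "a (Suc i) < a j" using t i by (simp add: s_def)
        then have "Suc i < j" using a_le[of j "Suc i"] j i by (metis Suc_leI not_le)
        then show False
          using a_le[of "Suc (Suc i)" j] j t aj by (simp add: s_def)
      next
        case False
        then have "(b + t) mod N = b + t - N" using tN bN by (simp add: mod_if)
        then have "a j < a 1" using j(3) tN a1 False by simp
        then show False using a_le[of 1 j] j by simp
      qed
    qed
  qed
  moreover have "(\<Prod>i<r. fib (2 * (s (Suc i) - s i))) = (\<Prod>i<r. fib (2 * cyclic_interval N R (Suc i)))"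
    by (intro prod.cong) (simp_all add: s_diff)
  moreover have "\<dots> = (\<Prod>i=1..r. fib (2 * cyclic_interval N R i))"
    by (simp add: prod.atLeast1_atMost_eq lessThan_atLeast0)
  moreover have "s r = N" by (simp add: s_def)
  ultimately show ?thesis
    using num_rooted_forests_wheel[OF assms(1,4) root] by simp
qed

end
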